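(* Let $M=\begin{pmatrix}a&b\\c&d\end{pmatrix}\in \mathrm{SL}_2(\mathbb{R})$ be a matrix with $b\neq 0$. Let $A=\sqrt{|b|}\,L_M$ be a rescaling of the linear canonical transformation $L_M$. Then $A:L^1(\mathbb{R})\to L^\infty(\mathbb{R})$ is $|b|$-Hadamard.
   Context: For $M=\begin{pmatrix}a&b\\c&d\end{pmatrix}\in\mathrm{SL}_2(\mathbb{R})$ with $b\ne0$, the linear canonical transformation $L_M$ is defined for $f\in L^1(\mathbb{R})$ by \[ (L_Mf)(\xi)=\frac{e^{-i\pi\operatorname{sgn}(b)/4}}{\sqrt{|b|}}\int_{\mathbb{R}} f(x)\,e^{i\pi(d\xi^2-2x\xi+ax^2)/b}\,dx . \] A linear operator $A:L^1(\mathbb{R})\to L^\infty(\mathbb{R})$ is called $k$-Hadamard (for $k>0$) if $\|A\|_{1\to\infty}\le 1$ (i.e. $\|Af\|_\infty\le\|f\|_1$ for all $f\in L^1(\mathbb{R})$) and $\|A^*Af\|_\infty\ge k\|f\|_\infty$ for all $f$ with $f\in L^1(\mathbb{R})$ and $Af\in L^1(\mathbb{R})$. Here $A^*:L^1(\mathbb{R})\to L^\infty(\mathbb{R})$ is the adjoint, determined by $\int (Af)\,\overline{g}\,dx=\int f\,\overline{A^*g}\,dx$ for all $f,g\in L^1(\mathbb{R})$. *)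

theory Defs
  imports "HOL-Probability.Probability"
begin

text \<open>
  Elements of \<open>L\<^sup>1(\<real>)\<close> and \<open>L\<^sup>\<infinity>(\<real>)\<close> are represented by functions rather than by
  classes modulo null sets, so operators are required to respect equality almost
  everywhere. The norms take values in \<^typ>\<open>ennreal\<close>: a function in \<open>L\<^sup>1\<close> need not be
  essentially bounded, in which case its sup norm is \<open>\<infinity>\<close>.
\<close>

definition L1 :: "(real \<Rightarrow> complex) set" where
  "L1 = {f. integrable lebesgue f}"

definition L1_norm :: "(real \<Rightarrow> complex) \<Rightarrow> ennreal" where
  "L1_norm f = (\<integral>\<^sup>+ x. ennreal (norm (f x)) \<partial>lebesgue)"

definition Linf_norm :: "(real \<Rightarrow> complex) \<Rightarrow> ennreal" where
  "Linf_norm f = esssup lebesgue (\<lambda>x. ennreal (norm (f x)))"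

definition Linf :: "(real \<Rightarrow> complex) set" where
  "Linf = {f. f \<in> borel_measurable lebesgue \<and> Linf_norm f < \<infinity>}"

definition linear_L1_Linf :: "((real \<Rightarrow> complex) \<Rightarrow> real \<Rightarrow> complex) \<Rightarrow> bool" where
  "linear_L1_Linf A \<longleftrightarrow>
     (\<forall>f\<in>L1. A f \<in> Linf) \<and>
     (\<forall>f\<in>L1. \<forall>g\<in>L1. (AE x in lebesgue. f x = g x) \<longrightarrow> (AE x in lebesgue. A f x = A g x)) \<and>
     (\<forall>f\<in>L1. \<forall>g\<in>L1. AE x in lebesgue. A (\<lambda>y. f y + g y) x = A f x + A g x) \<and>
     (\<forall>c. \<forall>f\<in>L1. AE x in lebesgue. A (\<lambda>y. c * f y) x = c * A f x)"

definition is_adjoint ::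
  "((real \<Rightarrow> complex) \<Rightarrow> real \<Rightarrow> complex) \<Rightarrow> ((real \<Rightarrow> complex) \<Rightarrow> real \<Rightarrow> complex) \<Rightarrow> bool" where
  "is_adjoint A B \<longleftrightarrow> linear_L1_Linf B \<and>
     (\<forall>f\<in>L1. \<forall>g\<in>L1. (LINT x|lebesgue. A f x * cnj (g x)) = (LINT x|lebesgue. f x * cnj (B g x)))"

lemma Linf_bound:
  assumes "h \<in> Linf"
  obtains C where "C \<ge> 0" "AE x in lebesgue. norm (h x) \<le> C"
proof -
  have m: "(\<lambda>x. ennreal (norm (h x))) \<in> borel_measurable lebesgue"
    using assms by (auto simp: Linf_def)
  obtain C where C: "C \<ge> 0" "Linf_norm h = ennreal C"
    using assms by (cases "Linf_norm h") (auto simp: Linf_def)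
  have "AE x in lebesgue. ennreal (norm (h x)) \<le> ennreal C"
    using esssup_AE[of "\<lambda>x. ennreal (norm (h x))" lebesgue] C(2) by (simp add: Linf_norm_def)
  then have "AE x in lebesgue. norm (h x) \<le> C"
    by eventually_elim (use C(1) in simp)
  then show ?thesis using that C(1) by blast
qed

lemma integrable_L1_Linf:
  assumes "f \<in> L1" "h \<in> Linf"
  shows "integrable lebesgue (\<lambda>x. f x * cnj (h x))"
proof -
  obtain C where C: "C \<ge> 0" "AE x in lebesgue. norm (h x) \<le> C"
    using Linf_bound[OF assms(2)] .
  have fh: "f \<in> borel_measurable lebesgue" "h \<in> borel_measurable lebesgue"
    using assms by (auto simp: L1_def Linf_def)
  show ?thesis
  proof (rule Bochner_Integration.integrable_bound)
    show "integrable lebesgue (\<lambda>x. f x * of_real C)"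
      using assms(1) by (simp add: L1_def)
    show "(\<lambda>x. f x * cnj (h x)) \<in> borel_measurable lebesgue"
      by (intro borel_measurable_times fh(1) measurable_compose[OF fh(2)]
          borel_measurable_continuous_onI continuous_intros)
    show "AE x in lebesgue. norm (f x * cnj (h x)) \<le> norm (f x * complex_of_real C)"
      using C(2) by eventually_elim (use C(1) in \<open>auto simp: norm_mult intro!: mult_left_mono\<close>)
  qed
qed

text \<open>
  The adjoint is determined up to null sets. Hence the existential quantifier over the
  adjoint in the definition of \<open>hadamard\<close> below involves no choice.
\<close>

lemma is_adjoint_unique:
  assumes B: "is_adjoint A B" and B': "is_adjoint A B'" and g: "g \<in> L1"
  shows "AE x in lebesgue. B g x = B' g x"
proof -
  define h where "h = (\<lambda>x. B g x - B' g x)"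
  have LB: "B g \<in> Linf" "B' g \<in> Linf"
    using B B' g by (auto simp: is_adjoint_def linear_L1_Linf_def)
  have [measurable]: "B g \<in> borel_measurable lebesgue" "B' g \<in> borel_measurable lebesgue"
    using LB by (auto simp: Linf_def)
  have hm [measurable]: "h \<in> borel_measurable lebesgue"
    unfolding h_def by measurable
  obtain C where C: "AE x in lebesgue. norm (B g x) \<le> C" using Linf_bound[OF LB(1)] .
  obtain C' where C': "AE x in lebesgue. norm (B' g x) \<le> C'" using Linf_bound[OF LB(2)] .
  have hb: "AE x in lebesgue. norm (h x) \<le> C + C'"
    using C C'
  proof eventually_elim
    case (elim x)
    then show ?case using norm_triangle_ineq4[of "B g x" "B' g x"] by (simp add: h_def)
  qed
  have "AE x in lebesgue. x \<in> {- real n..real n} \<longrightarrow> h x = 0" for n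
  proof -
    let ?S = "{- real n..real n}"
    define f where "f = (\<lambda>x. indicator ?S x *\<^sub>R h x)"
    have fL: "f \<in> L1"
      unfolding L1_def f_def mem_Collect_eq
    proof (rule Bochner_Integration.integrable_bound)
      show "integrable lebesgue (\<lambda>x. (C + C') * indicator ?S x :: real)"
        by (intro integrable_mult_right integrable_real_indicator) auto
      show "(\<lambda>x. indicator ?S x *\<^sub>R h x) \<in> borel_measurable lebesgue"
        by (intro borel_measurable_scaleR borel_measurable_indicator hm) simp
      show "AE x in lebesgue. norm (indicator ?S x *\<^sub>R h x) \<le> norm ((C + C') * indicator ?S x :: real)"
        using hb by eventually_elim (auto simp: indicator_def)
    qed
    have i: "integrable lebesgue (\<lambda>x. f x * cnj (B g x))" "integrable lebesgue (\<lambda>x. f x * cnj (B' g x))"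
      using fL LB by (auto intro: integrable_L1_Linf)
    have eq: "f x * cnj (B g x) - f x * cnj (B' g x) = complex_of_real (indicator ?S x * (norm (h x))\<^sup>2)" for x
    proof -
      have "f x * cnj (B g x) - f x * cnj (B' g x) = f x * cnj (h x)"
        by (simp add: h_def algebra_simps)
      also have "\<dots> = complex_of_real (indicator ?S x) * (h x * cnj (h x))"
        by (simp add: f_def scaleR_conv_of_real)
      also have "\<dots> = complex_of_real (indicator ?S x * (norm (h x))\<^sup>2)"
        by (simp only: complex_norm_square of_real_mult)
      finally show ?thesis .
    qed
    have "(LINT x|lebesgue. f x * cnj (B g x)) = (LINT x|lebesgue. f x * cnj (B' g x))"
      using B B' g fL unfolding is_adjoint_def by metis
    then have "(LINT x|lebesgue. f x * cnj (B g x) - f x * cnj (B' g x)) = 0"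
      using i by simp
    then have z: "(LINT x|lebesgue. indicator ?S x * (norm (h x))\<^sup>2) = 0"
      unfolding eq integral_complex_of_real by simp
    have "integrable lebesgue (\<lambda>x. complex_of_real (indicator ?S x * (norm (h x))\<^sup>2))"
      using Bochner_Integration.integrable_diff[OF i] unfolding eq .
    then have "integrable lebesgue (\<lambda>x. indicator ?S x * (norm (h x))\<^sup>2)"
      by (simp only: complex_of_real_integrable_eq)
    then have "AE x in lebesgue. indicator ?S x * (norm (h x))\<^sup>2 = 0"
      using z by (subst (asm) integral_nonneg_eq_0_iff_AE) auto
    then show ?thesis by eventually_elim auto
  qed
  then have "AE x in lebesgue. \<forall>n. x \<in> {- real n..real n} \<longrightarrow> h x = 0"
    unfolding AE_all_countable by blast
  then show ?thesis
  proof eventually_elim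
    case (elim x)
    obtain n where "\<bar>x\<bar> \<le> real n" using real_arch_simple by blast
    then have "x \<in> {- real n..real n}" by auto
    then show ?case using elim unfolding h_def by (metis eq_iff_diff_eq_0)
  qed
qed

definition hadamard :: "real \<Rightarrow> ((real \<Rightarrow> complex) \<Rightarrow> real \<Rightarrow> complex) \<Rightarrow> bool" where
  "hadamard k A \<longleftrightarrow> 0 < k \<and> linear_L1_Linf A \<and>
     (\<forall>f\<in>L1. Linf_norm (A f) \<le> L1_norm f) \<and>
     (\<exists>B. is_adjoint A B \<and>
       (\<forall>f. f \<in> L1 \<and> A f \<in> L1 \<longrightarrow> Linf_norm (B (A f)) \<ge> ennreal k * Linf_norm f))"

text \<open>The linear canonical transformation of \<open>M\<close> with rows \<open>(a, b)\<close> and \<open>(c, d)\<close>, meaningful for \<open>b \<noteq> 0\<close> only.\<close>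

definition lct :: "real^2^2 \<Rightarrow> (real \<Rightarrow> complex) \<Rightarrow> real \<Rightarrow> complex" where
  "lct M f \<xi> = (let a = M$1$1; b = M$1$2; d = M$2$2 in
     exp (- (\<i> * of_real (pi * sgn b / 4))) / of_real (sqrt \<bar>b\<bar>) *
     (LINT x|lebesgue. f x * exp (\<i> * of_real (pi * (d * \<xi>\<^sup>2 - 2 * x * \<xi> + a * x\<^sup>2) / b))))"

end

theory Submission
  imports Defs
begin

text \<open>
  Up to a unimodular constant, \<open>A\<close> is the integral operator with the kernel
  \<open>K(x, \<xi>) = exp (i \<pi> (d \<xi>\<^sup>2 - 2 x \<xi> + a x\<^sup>2) / b)\<close>, which has modulus one. Every operator
  with a kernel of modulus at most one is a contraction from \<open>L\<^sup>1\<close> to \<open>L\<^sup>\<infinity>\<close>, and by Fubini's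
  theorem its adjoint has the conjugate transposed kernel (\<open>is_adjoint_kernel_op\<close>).

  The kernel factors as a chirp in \<open>x\<close>, times a Fourier kernel of frequency \<open>2 \<pi> \<xi> / b\<close>, times
  a chirp in \<open>\<xi>\<close> (\<open>lct_kernel_split\<close>). So \<open>A\<close> multiplies \<open>f\<close> by a chirp, takes the Fourier
  transform of the product \<open>F\<close>, rescales it, and multiplies by a second chirp. In \<open>A\<^sup>* A f\<close>
  the second chirp cancels, rescaling back contributes the factor \<open>\<bar>b\<bar> / (2 \<pi>)\<close>, the inverse
  Fourier transform recovers \<open>2 \<pi> F\<close>, and the first chirp is undone. Hence
  \<open>\<bar>A\<^sup>* A f\<bar> = \<bar>b\<bar> \<bar>f\<bar>\<close> almost everywhere (\<open>adjoint_lct_kernel_op\<close>), and the Hadamard bound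
  holds with equality.

  The analytic core is Fourier inversion for an integrable function with integrable Fourier
  transform (\<open>fourier_inversion_L1\<close>). Damping the inverse transform by a Gaussian of width \<open>1 / e\<close>
  turns it into \<open>2 \<pi>\<close> times the convolution of \<open>F\<close> with the centred normal density of standard
  deviation \<open>e\<close>. Instead
  of proving that the convolutions converge to \<open>F\<close> in \<open>L\<^sup>1\<close>, the proof integrates both sides over
  an interval: the smoothing can then be moved from \<open>F\<close> to the indicator function of the interval,
  where convergence as \<open>e \<rightarrow> 0\<close> is pointwise off the end points. A function whose integral over
  every interval vanishes is zero almost everywhere.
\<close>

section \<open>Fubini's theorem for bounded kernels\<close>

lemma integrable_product_kernel:
  fixes f g :: "real \<Rightarrow> complex" and K :: "real \<Rightarrow> real \<Rightarrow> complex"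
  assumes f: "integrable lborel f" and g: "integrable lborel g"
    and K [measurable]: "case_prod K \<in> borel_measurable (borel \<Otimes>\<^sub>M borel)"
    and K1: "\<And>x y. norm (K x y) \<le> 1"
  shows "integrable (lborel \<Otimes>\<^sub>M lborel) (\<lambda>(x, y). f x * K x y * g y)"
proof (rule Bochner_Integration.integrable_bound)
  have [measurable]: "f \<in> borel_measurable borel" "g \<in> borel_measurable borel"
    using f g by (auto dest: borel_measurable_integrable)
  show "integrable (lborel \<Otimes>\<^sub>M lborel) (\<lambda>(x, y). f x * g y)"
    using f g by (intro lborel_pair.Fubini_integrable) (auto simp: norm_mult)
  show "(\<lambda>(x, y). f x * K x y * g y) \<in> borel_measurable (lborel \<Otimes>\<^sub>M lborel)"
    by measurable
  have "norm (f x * K x y * g y) \<le> norm (f x * g y)" for x y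
    using mult_mono[OF mult_mono[OF order_refl[of "norm (f x)"] K1[of x y]] order_refl[of "norm (g y)"]]
    by (simp add: norm_mult)
  then show "AE z in lborel \<Otimes>\<^sub>M lborel. norm (case z of (x, y) \<Rightarrow> f x * K x y * g y)
      \<le> norm (case z of (x, y) \<Rightarrow> f x * g y)"
    by auto
qed

text \<open>
  The form in which Fubini's theorem serves three times below: for the adjoint relation, for
  inserting the Fourier transform into a Gaussian average, and for moving a convolution to the
  test function.
\<close>

lemma Fubini_kernel:
  fixes f g :: "real \<Rightarrow> complex" and K :: "real \<Rightarrow> real \<Rightarrow> complex"
  assumes f: "integrable lborel f" and g: "integrable lborel g"
    and K: "case_prod K \<in> borel_measurable (borel \<Otimes>\<^sub>M borel)"
    and K1: "\<And>x y. norm (K x y) \<le> 1"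
  shows "(LINT y|lborel. (LINT x|lborel. f x * K x y) * g y)
       = (LINT x|lborel. f x * (LINT y|lborel. K x y * g y))"
proof -
  have "(LINT y|lborel. (LINT x|lborel. f x * K x y) * g y)
      = (LINT y|lborel. LINT x|lborel. f x * K x y * g y)"
    by simp
  also have "\<dots> = (LINT x|lborel. LINT y|lborel. f x * K x y * g y)"
    using lborel_pair.Fubini_integral[OF integrable_product_kernel[OF assms]] by simp
  also have "\<dots> = (LINT x|lborel. f x * (LINT y|lborel. K x y * g y))"
    by (simp add: mult.assoc)
  finally show ?thesis .
qed

section \<open>Gaussian summation of the inverse Fourier transform\<close>

lemma iexp_std_normal_integral:
  "(LINT z|lborel. iexp (s * z) * of_real (std_normal_density z)) = of_real (exp (- s\<^sup>2 / 2))"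
proof -
  have "(LINT z|lborel. iexp (s * z) * of_real (std_normal_density z)) = char std_normal_distribution s"
    unfolding char_def
    by (subst integral_density) (auto simp: scaleR_conv_of_real mult.commute)
  then show ?thesis by (simp add: char_std_normal_distribution)
qed

lemma exp_neg_square_eq_normal_density: "exp (- x\<^sup>2 / 2) = sqrt (2 * pi) * std_normal_density x"
  by (simp add: std_normal_density_def)

text \<open>
  The Gaussian is its own Fourier transform; a contraction of the variable by \<open>e\<close> becomes a
  dilation by \<open>1 / e\<close> on the other side.
\<close>

lemma iexp_scaled_normal_integral:
  assumes e: "0 < e"
  shows "(LINT t|lborel. iexp (t * w) * of_real (exp (- (e * t)\<^sup>2 / 2)))
       = of_real (2 * pi / e * std_normal_density (w / e))"
proof -
  have "(LINT t|lborel. iexp (t * w) * of_real (exp (- (e * t)\<^sup>2 / 2)))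
     = (LINT t|lborel. of_real (sqrt (2 * pi)) * (iexp ((w / e) * (0 + e * t)) * of_real (std_normal_density (0 + e * t))))"
    using e by (intro Bochner_Integration.integral_cong refl)
       (simp only: add_0_left exp_neg_square_eq_normal_density of_real_mult, simp add: mult_ac)
  also have "\<dots> = of_real (sqrt (2 * pi) / e) * (LINT t|lborel. iexp ((w / e) * t) * of_real (std_normal_density t))"
    using e by (subst (2) lborel_integral_real_affine[where c=e and t=0]) (auto simp: scaleR_conv_of_real)
  also have "\<dots> = of_real (2 * pi / e * std_normal_density (w / e))"
    unfolding iexp_std_normal_integral exp_neg_square_eq_normal_density of_real_mult[symmetric]
    by (simp add: field_simps)
  finally show ?thesis .
qed

text \<open>
  Almost every point is a Lebesgue point: there \<open>D x\<close> is the limit of the averages of \<open>D\<close> over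
  the intervals \<open>{x..x + h}\<close>, all of which vanish.
\<close>

lemma AE_zero_if_interval_integrals_zero:
  fixes D :: "real \<Rightarrow> complex"
  assumes D: "\<And>p q. set_integrable lborel {p..q} D"
    and z: "\<And>p q. (LINT x:{p..q}|lborel. D x) = 0"
  shows "AE x in lborel. D x = 0"
proof -
  have I: "(D has_integral 0) (cbox p q)" for p q
    using set_borel_integral_eq_integral[OF D[of p q]] z[of p q]
    by (simp add: has_integral_iff)
  obtain N where N: "negligible N" and
    *: "\<And>x e. \<lbrakk>x \<notin> N; 0 < e\<rbrakk> \<Longrightarrow>
      \<exists>d>0. \<forall>h. 0 < h \<and> h < d \<longrightarrow> norm (integral (cbox x (x + h *\<^sub>R One)) D /\<^sub>R h ^ DIM(real) - D x) < e"
    using integrable_ccontinuous_explicit[of D] I by blast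
  have "D x = 0" if xN: "x \<notin> N" for x
  proof (rule ccontr)
    assume "D x \<noteq> 0"
    then obtain d where "d > 0" "\<forall>h. 0 < h \<and> h < d \<longrightarrow>
        norm (integral (cbox x (x + h *\<^sub>R One)) D /\<^sub>R h ^ DIM(real) - D x) < norm (D x)"
      using *[OF xN, of "norm (D x)"] by auto
    then have "norm (integral (cbox x (x + (d/2) *\<^sub>R One)) D /\<^sub>R (d/2) ^ DIM(real) - D x) < norm (D x)"
      by (metis half_gt_zero field_sum_of_halves less_add_same_cancel1)
    then show False
      unfolding integral_unique[OF I] by simp
  qed
  then have "AE x in lebesgue. D x = 0"
    using N by (intro AE_I'[of N]) (auto simp: negligible_iff_null_sets)
  then show ?thesis by (simp add: AE_completion_iff)
qed

lemma integrable_gaussian: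
  assumes "0 < e"
  shows "integrable lborel (\<lambda>t. exp (- (e * t)\<^sup>2 / 2) :: real)"
proof -
  have "integrable lborel (\<lambda>t. sqrt (2 * pi) * std_normal_density (0 + e * t))"
    using assms by (intro integrable_mult_right lborel_integrable_real_affine) auto
  then show ?thesis
    by (simp only: exp_neg_square_eq_normal_density add_0_left)
qed

text \<open>
  The transform of \<open>F\<close> is bounded and the weight is integrable, so the order of integration may be
  exchanged; the inner integral is then the transform of a Gaussian.
  The result is \<open>2 \<pi>\<close> times an average of \<open>F\<close> near \<open>x\<close>.
\<close>

lemma gaussian_summation:
  fixes F :: "real \<Rightarrow> complex"
  assumes F: "integrable lborel F" and e: "0 < e"
  shows "(LINT t|lborel. (LINT y|lborel. F y * iexp (- (t * y))) * (iexp (t * x) * of_real (exp (- (e * t)\<^sup>2 / 2))))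
       = (LINT y|lborel. F y * of_real (2 * pi / e * std_normal_density ((x - y) / e)))"
proof -
  have g: "integrable lborel (\<lambda>t. iexp (t * x) * of_real (exp (- (e * t)\<^sup>2 / 2)))"
    by (rule Bochner_Integration.integrable_bound[OF integrable_gaussian[OF e]])
       (auto simp: norm_mult simp del: of_real_exp)
  have "(LINT t|lborel. (LINT y|lborel. F y * iexp (- (t * y))) * (iexp (t * x) * of_real (exp (- (e * t)\<^sup>2 / 2))))
      = (LINT y|lborel. F y * (LINT t|lborel. iexp (- (t * y)) * (iexp (t * x) * of_real (exp (- (e * t)\<^sup>2 / 2)))))"
    by (rule Fubini_kernel[OF F g]) (auto simp del: of_real_mult of_real_minus)
  also have "\<dots> = (LINT y|lborel. F y * (LINT t|lborel. iexp (t * (x - y)) * of_real (exp (- (e * t)\<^sup>2 / 2))))"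
    by (simp add: exp_add[symmetric] mult.assoc[symmetric] right_diff_distrib del: of_real_exp)
  finally show ?thesis
    by (simp only: iexp_scaled_normal_integral[OF e])
qed

lemma std_normal_density_le_1: "std_normal_density x \<le> 1"
proof -
  have "1 / sqrt (2 * pi) \<le> 1" using pi_ge_two by (simp add: real_le_rsqrt)
  then have "1 / sqrt (2 * pi) * exp (- x\<^sup>2 / 2) \<le> 1 * 1"
    by (intro mult_mono) auto
  then show ?thesis by (simp add: std_normal_density_def)
qed

text \<open>
  By Fubini's theorem, the smoothing moves from \<open>F\<close> to the test function \<open>\<phi>\<close>.
  The substitution \<open>x = y + e z\<close> frees the density from \<open>e\<close>, which
  prepares the limit \<open>e \<rightarrow> 0\<close> by dominated convergence.
\<close>

lemma integral_gaussian_convolution: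
  fixes F \<phi> :: "real \<Rightarrow> complex"
  assumes F: "integrable lborel F" and \<phi>: "integrable lborel \<phi>" and e: "0 < e"
  shows "(LINT x|lborel. (LINT y|lborel. F y * of_real (2 * pi / e * std_normal_density ((x - y) / e))) * \<phi> x)
       = 2 * pi * (LINT y|lborel. F y * (LINT z|lborel. of_real (std_normal_density z) * \<phi> (y + e * z)))"
proof -
  have inner: "(LINT x|lborel. of_real (std_normal_density ((x - y) / e)) * \<phi> x)
      = e * (LINT z|lborel. of_real (std_normal_density z) * \<phi> (y + e * z))" for y
    using e by (subst lborel_integral_real_affine[where c=e and t=y]) (auto simp: scaleR_conv_of_real)
  have "F y * of_real (2 * pi / e * std_normal_density ((x - y) / e))
      = (2 * pi / e) * (F y * of_real (std_normal_density ((x - y) / e)))" for x y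
    by (simp add: mult_ac)
  then have "(LINT x|lborel. (LINT y|lborel. F y * of_real (2 * pi / e * std_normal_density ((x - y) / e))) * \<phi> x)
      = (2 * pi / e) * (LINT x|lborel. (LINT y|lborel. F y * of_real (std_normal_density ((x - y) / e))) * \<phi> x)"
    by (simp only: integral_mult_right_zero mult.assoc)
  also have "(LINT x|lborel. (LINT y|lborel. F y * of_real (std_normal_density ((x - y) / e))) * \<phi> x)
      = (LINT y|lborel. F y * (LINT x|lborel. of_real (std_normal_density ((x - y) / e)) * \<phi> x))"
    by (rule Fubini_kernel[OF F \<phi>]) (auto simp: std_normal_density_le_1)
  also have "\<dots> = (LINT y|lborel. F y * (e * (LINT z|lborel. of_real (std_normal_density z) * \<phi> (y + e * z))))"
    unfolding inner ..
  also have "\<dots> = e * (LINT y|lborel. F y * (LINT z|lborel. of_real (std_normal_density z) * \<phi> (y + e * z)))"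
    by (simp only: mult.left_commute[of _ "complex_of_real e"] integral_mult_right_zero)
  finally show ?thesis using e by simp
qed

section \<open>Fourier inversion\<close>

text \<open>
  Let \<open>H\<close> be the undamped inverse transform. For a sequence of widths tending to zero, the damped
  inverse transforms converge boundedly to \<open>H\<close>, because the transform is integrable. Tested against
  an interval, the smoothed copies of \<open>F\<close> converge to \<open>2 \<pi> F\<close>, because \<open>F\<close> is integrable. So \<open>H\<close>
  and \<open>2 \<pi> F\<close> have the same integral over every interval.
\<close>

lemma fourier_inversion_L1:
  fixes F :: "real \<Rightarrow> complex"
  defines "Fh \<equiv> \<lambda>t. LINT y|lborel. F y * iexp (- (t * y))"
  assumes F: "integrable lborel F" and Fh: "integrable lborel Fh"
  shows "AE x in lborel. (LINT t|lborel. Fh t * iexp (t * x)) = 2 * pi * F x"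
proof -
  define H where "H = (\<lambda>x. LINT t|lborel. Fh t * iexp (t * x))"
  have [measurable]: "F \<in> borel_measurable borel" "Fh \<in> borel_measurable borel"
    using F Fh by (auto dest: borel_measurable_integrable)
  have [measurable]: "H \<in> borel_measurable borel"
    unfolding H_def by measurable
  define u where "u = (\<lambda>m. 1 / real (Suc m))"
  have u0: "u m > 0" for m by (simp add: u_def)
  have ulim: "u \<longlonglongrightarrow> 0"
    unfolding u_def using LIMSEQ_inverse_real_of_nat by (simp add: inverse_eq_divide)
  define C where "C = (LINT t|lborel. norm (Fh t))"
  \<comment> \<open>A bound uniform in \<open>e\<close>; the case \<open>e = 0\<close> is \<open>H\<close> itself.\<close>
  have HC: "norm (LINT t|lborel. Fh t * (iexp (t * x) * of_real (exp (- (e * t)\<^sup>2 / 2)))) \<le> C" for e x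
    unfolding C_def
    by (intro order_trans[OF integral_norm_bound] integral_mono')
       (use Fh in \<open>auto simp: norm_mult mult_left_le simp del: of_real_exp\<close>)
  have HC': "norm (H x) \<le> C" for x
    using HC[where e=0] by (simp add: H_def)
  have "AE x in lborel. H x - 2 * pi * F x = 0"
  proof (rule AE_zero_if_interval_integrals_zero)
    fix p q :: real
    define \<phi> :: "real \<Rightarrow> complex" where "\<phi> = (\<lambda>x. indicator {p..q} x)"
    have [measurable]: "\<phi> \<in> borel_measurable borel" unfolding \<phi>_def by measurable
    have \<phi>1: "norm (\<phi> x) \<le> 1" for x by (simp add: \<phi>_def indicator_def)
    have \<phi>i: "integrable lborel \<phi>"
    proof -
      have "integrable lborel (\<lambda>x. complex_of_real (indicator {p..q} x))"
        by (intro integrable_of_real integrable_real_indicator) (auto simp: emeasure_lborel_Icc_eq)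
      then show ?thesis by (simp add: \<phi>_def of_real_indicator)
    qed
    have H\<phi>: "integrable lborel (\<lambda>x. H x * \<phi> x)"
      by (rule Bochner_Integration.integrable_bound[OF integrable_mult_right[OF \<phi>i, of "of_real C"]])
         (auto simp: norm_mult intro!: mult_right_mono order_trans[OF HC'])
    have F\<phi>: "integrable lborel (\<lambda>x. F x * \<phi> x)"
      by (rule Bochner_Integration.integrable_bound[OF F]) (auto simp: norm_mult mult_left_le \<phi>1)
    have sm: "indicator {p..q} x *\<^sub>R (H x - 2 * pi * F x) = H x * \<phi> x - 2 * pi * (F x * \<phi> x)" for x
      by (auto simp: \<phi>_def indicator_def)
    show "set_integrable lborel {p..q} (\<lambda>x. H x - 2 * pi * F x)"
      unfolding set_integrable_def sm using H\<phi> F\<phi> by auto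
    \<comment> \<open>First limit: the damping disappears, under the dominating functions \<open>\<bar>Fh\<bar>\<close> and \<open>C \<bar>\<phi>\<bar>\<close>.\<close>
    have L: "(\<lambda>m. LINT x|lborel. (LINT t|lborel. Fh t * (iexp (t * x) * of_real (exp (- (u m * t)\<^sup>2 / 2)))) * \<phi> x)
        \<longlonglongrightarrow> (LINT x|lborel. H x * \<phi> x)"
    proof (rule integral_dominated_convergence[where w="\<lambda>x. C * norm (\<phi> x)"])
      show "integrable lborel (\<lambda>x. C * norm (\<phi> x))" using \<phi>i by auto
      show "AE x in lborel. (\<lambda>m. (LINT t|lborel. Fh t * (iexp (t * x) * of_real (exp (- (u m * t)\<^sup>2 / 2)))) * \<phi> x) \<longlonglongrightarrow> H x * \<phi> x"
      proof (intro AE_I2 tendsto_mult tendsto_const)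
        fix x
        show "(\<lambda>m. LINT t|lborel. Fh t * (iexp (t * x) * of_real (exp (- (u m * t)\<^sup>2 / 2)))) \<longlonglongrightarrow> H x"
          unfolding H_def
        proof (rule integral_dominated_convergence[where w="\<lambda>t. norm (Fh t)"])
          have "(\<lambda>m. Fh t * (iexp (t * x) * of_real (exp (- (u m * t)\<^sup>2 / 2)))) \<longlonglongrightarrow>
              Fh t * (iexp (t * x) * of_real (exp (- (0 * t)\<^sup>2 / 2)))" for t
            by (intro tendsto_intros ulim) auto
          then show "AE t in lborel. (\<lambda>m. Fh t * (iexp (t * x) * of_real (exp (- (u m * t)\<^sup>2 / 2)))) \<longlonglongrightarrow> Fh t * iexp (t * x)"
            by simp
        qed (use Fh in \<open>auto simp: norm_mult mult_left_le simp del: of_real_exp\<close>)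
      qed
      show "AE x in lborel. norm ((LINT t|lborel. Fh t * (iexp (t * x) * of_real (exp (- (u m * t)\<^sup>2 / 2)))) * \<phi> x)
          \<le> C * norm (\<phi> x)" for m
        unfolding norm_mult by (intro AE_I2 mult_right_mono HC norm_ge_zero)
    qed measurable
    \<comment> \<open>Second limit: the smoothing of the indicator disappears except at the two end points,
      which form a null set.\<close>
    have R: "(\<lambda>m. LINT y|lborel. F y * (LINT z|lborel. of_real (std_normal_density z) * \<phi> (y + u m * z)))
        \<longlonglongrightarrow> (LINT y|lborel. F y * \<phi> y)"
    proof (rule integral_dominated_convergence[where w="\<lambda>y. norm (F y)"])
      show "AE y in lborel. norm (F y * (LINT z|lborel. of_real (std_normal_density z) * \<phi> (y + u m * z))) \<le> norm (F y)" for m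
      proof (intro AE_I2)
        fix y
        have "norm (LINT z|lborel. of_real (std_normal_density z) * \<phi> (y + u m * z)) \<le> (LINT z|lborel. std_normal_density z)"
          by (intro order_trans[OF integral_norm_bound] integral_mono') (auto simp: norm_mult mult_left_le \<phi>1)
        then show "norm (F y * (LINT z|lborel. of_real (std_normal_density z) * \<phi> (y + u m * z))) \<le> norm (F y)"
          by (simp add: norm_mult mult_left_le)
      qed
      have "AE y in lborel. y \<noteq> p \<and> y \<noteq> q"
        using AE_lborel_singleton[of p] AE_lborel_singleton[of q] by auto
      then show "AE y in lborel. (\<lambda>m. F y * (LINT z|lborel. of_real (std_normal_density z) * \<phi> (y + u m * z))) \<longlonglongrightarrow> F y * \<phi> y"
      proof eventually_elim
        fix y assume y: "y \<noteq> p \<and> y \<noteq> q"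
        have "y \<notin> frontier {p..q}" using y by (auto simp: frontier_def)
        then have c: "isCont \<phi> y"
          using isCont_of_real[of y "indicator {p..q}"]
          by (simp add: \<phi>_def isCont_indicator of_real_indicator)
        have "(\<lambda>m. LINT z|lborel. of_real (std_normal_density z) * \<phi> (y + u m * z)) \<longlonglongrightarrow>
            (LINT z|lborel. of_real (std_normal_density z) * \<phi> y)"
        proof (rule integral_dominated_convergence[where w="std_normal_density"])
          show "AE z in lborel. (\<lambda>m. complex_of_real (std_normal_density z) * \<phi> (y + u m * z)) \<longlonglongrightarrow> of_real (std_normal_density z) * \<phi> y"
          proof (intro AE_I2 tendsto_mult tendsto_const isCont_tendsto_compose[OF c])
            fix z
            have "(\<lambda>m. y + u m * z) \<longlonglongrightarrow> y + 0 * z" by (intro tendsto_intros ulim)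
            then show "(\<lambda>m. y + u m * z) \<longlonglongrightarrow> y" by simp
          qed
        qed (auto simp: norm_mult mult_left_le \<phi>1)
        then show "(\<lambda>m. F y * (LINT z|lborel. of_real (std_normal_density z) * \<phi> (y + u m * z))) \<longlonglongrightarrow> F y * \<phi> y"
          by (intro tendsto_intros) simp
      qed
    qed (use F in auto)
    have eq: "(LINT x|lborel. (LINT t|lborel. Fh t * (iexp (t * x) * of_real (exp (- (u m * t)\<^sup>2 / 2)))) * \<phi> x)
        = 2 * pi * (LINT y|lborel. F y * (LINT z|lborel. of_real (std_normal_density z) * \<phi> (y + u m * z)))" for m
      unfolding Fh_def gaussian_summation[OF F u0] by (rule integral_gaussian_convolution[OF F \<phi>i u0])
    have "(LINT x|lborel. H x * \<phi> x) = 2 * pi * (LINT y|lborel. F y * \<phi> y)"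
      using L[unfolded eq] tendsto_mult_left[OF R, of "2 * pi"] by (rule LIMSEQ_unique)
    then show "(LINT x:{p..q}|lborel. H x - 2 * pi * F x) = 0"
      unfolding set_lebesgue_integral_def sm using H\<phi> F\<phi> by simp
  qed
  then show ?thesis by (simp add: H_def)
qed

section \<open>Operators with a bounded kernel\<close>

text \<open>
  Fubini's theorem needs Borel functions, since the completed measure does not behave well under
  products; this representative gives access to it from \<open>L\<^sup>1\<close> of the completed measure.
\<close>

lemma L1_borel_representative:
  assumes "f \<in> L1"
  obtains f' where "integrable lborel f'" "AE x in lborel. f x = f' x"
proof -
  have f: "integrable lebesgue f" using assms by (simp add: L1_def)
  then have [measurable]: "f \<in> borel_measurable lebesgue" by auto
  have "(\<lambda>x. Re (f x)) \<in> borel_measurable lebesgue" "(\<lambda>x. Im (f x)) \<in> borel_measurable lebesgue"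
    by measurable
  then obtain r i where r: "r \<in> borel_measurable lborel" "AE x in lborel. Re (f x) = r x"
    and i: "i \<in> borel_measurable lborel" "AE x in lborel. Im (f x) = i x"
    using completion_ex_borel_measurable_real[of "\<lambda>x. Re (f x)" lborel]
      completion_ex_borel_measurable_real[of "\<lambda>x. Im (f x)" lborel] by metis
  define f' where "f' = (\<lambda>x. complex_of_real (r x) + \<i> * complex_of_real (i x))"
  have m: "f' \<in> borel_measurable lborel"
    unfolding f'_def by (intro borel_measurable_add borel_measurable_times borel_measurable_const
        measurable_compose[OF r(1) borel_measurable_of_real] measurable_compose[OF i(1) borel_measurable_of_real])
  have eq: "AE x in lborel. f x = f' x"
    using r(2) i(2) by eventually_elim (simp add: f'_def complex_eq_iff)
  have "integrable lebesgue f'"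
    using integrable_cong_AE_imp[OF f measurable_completion[OF m]] AE_completion[OF eq] by (simp add: eq_commute)
  then have "integrable lborel f'"
    using m by (simp add: integrable_completion)
  then show ?thesis using that eq by blast
qed

definition kernel_op :: "(real \<Rightarrow> real \<Rightarrow> complex) \<Rightarrow> (real \<Rightarrow> complex) \<Rightarrow> real \<Rightarrow> complex" where
  "kernel_op K f y = (LINT x|lebesgue. f x * K x y)"

definition unit_kernel :: "(real \<Rightarrow> real \<Rightarrow> complex) \<Rightarrow> bool" where
  "unit_kernel K \<longleftrightarrow> case_prod K \<in> borel_measurable (borel \<Otimes>\<^sub>M borel) \<and> (\<forall>x y. norm (K x y) \<le> 1)"

definition adjoint_kernel :: "(real \<Rightarrow> real \<Rightarrow> complex) \<Rightarrow> real \<Rightarrow> real \<Rightarrow> complex" where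
  "adjoint_kernel K y x = cnj (K x y)"

lemma borel_measurable_cnj [measurable]: "cnj \<in> borel_measurable borel"
  by (intro borel_measurable_continuous_onI continuous_intros)

lemma unit_kernel_adjoint:
  assumes "unit_kernel K"
  shows "unit_kernel (adjoint_kernel K)"
proof -
  have [measurable]: "case_prod K \<in> borel_measurable (borel \<Otimes>\<^sub>M borel)"
    using assms by (simp add: unit_kernel_def)
  have "case_prod (adjoint_kernel K) \<in> borel_measurable (borel \<Otimes>\<^sub>M borel)"
    unfolding adjoint_kernel_def by measurable
  then show ?thesis
    using assms by (simp add: unit_kernel_def adjoint_kernel_def)
qed

lemma integrable_times_unit_kernel:
  assumes K: "unit_kernel K" and f: "f \<in> L1"
  shows "integrable lebesgue (\<lambda>x. f x * K x y)"
proof (rule Bochner_Integration.integrable_bound)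
  show "integrable lebesgue f" using f by (simp add: L1_def)
  have [measurable]: "case_prod K \<in> borel_measurable (borel \<Otimes>\<^sub>M borel)"
    using K by (simp add: unit_kernel_def)
  have "(\<lambda>x. K x y) \<in> borel_measurable borel" by measurable
  then have "(\<lambda>x. K x y) \<in> borel_measurable lebesgue"
    by (simp add: measurable_completion)
  then show "(\<lambda>x. f x * K x y) \<in> borel_measurable lebesgue"
    using f by (intro borel_measurable_times) (auto simp: L1_def)
  show "AE x in lebesgue. norm (f x * K x y) \<le> norm (f x)"
    using K by (auto simp: norm_mult mult_left_le unit_kernel_def)
qed

lemma kernel_op_cong_AE:
  assumes K: "unit_kernel K" and "f \<in> L1" "g \<in> L1" and "AE x in lebesgue. f x = g x"
  shows "kernel_op K f = kernel_op K g"
proof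
  fix y
  show "kernel_op K f y = kernel_op K g y"
    unfolding kernel_op_def
    by (rule integral_cong_AE)
       (use assms integrable_times_unit_kernel[OF K] in \<open>auto dest: borel_measurable_integrable\<close>)
qed

lemma kernel_op_borel:
  assumes K: "unit_kernel K" and f: "integrable lborel f"
  shows "kernel_op K f y = (LINT x|lborel. f x * K x y)"
proof -
  have [measurable]: "case_prod K \<in> borel_measurable (borel \<Otimes>\<^sub>M borel)" "f \<in> borel_measurable borel"
    using K f by (auto simp: unit_kernel_def dest: borel_measurable_integrable)
  show ?thesis unfolding kernel_op_def by (intro integral_completion) measurable
qed

lemma L1_if_integrable_lborel: "integrable lborel f \<Longrightarrow> f \<in> L1"
  by (auto simp: L1_def integrable_completion dest: borel_measurable_integrable)

lemma kernel_op_representative: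
  assumes K: "unit_kernel K" and f: "f \<in> L1"
  obtains f' where "integrable lborel f'" "AE x in lborel. f x = f' x"
    "kernel_op K f = (\<lambda>y. LINT x|lborel. f' x * K x y)"
proof -
  obtain f' where f': "integrable lborel f'" "AE x in lborel. f x = f' x"
    using L1_borel_representative[OF f] .
  have "kernel_op K f = kernel_op K f'"
    by (rule kernel_op_cong_AE[OF K f L1_if_integrable_lborel[OF f'(1)] AE_completion[OF f'(2)]])
  then show ?thesis using that[OF f'] kernel_op_borel[OF K f'(1)] by (auto simp: fun_eq_iff)
qed

lemma borel_measurable_kernel_op:
  assumes K: "unit_kernel K" and f: "f \<in> L1"
  shows "kernel_op K f \<in> borel_measurable borel"
proof -
  obtain f' where f': "integrable lborel f'" "kernel_op K f = (\<lambda>y. LINT x|lborel. f' x * K x y)"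
    using kernel_op_representative[OF K f] by blast
  have [measurable]: "case_prod K \<in> borel_measurable (borel \<Otimes>\<^sub>M borel)" "f' \<in> borel_measurable borel"
    using K f' by (auto simp: unit_kernel_def dest: borel_measurable_integrable)
  show ?thesis unfolding f'(2) by measurable
qed

lemma norm_kernel_op_le:
  assumes K: "unit_kernel K" and f: "f \<in> L1"
  shows "ennreal (norm (kernel_op K f y)) \<le> L1_norm f"
proof -
  have "ennreal (norm (kernel_op K f y)) \<le> (\<integral>\<^sup>+ x. norm (f x * K x y) \<partial>lebesgue)"
    unfolding kernel_op_def by (rule integral_norm_bound_ennreal[OF integrable_times_unit_kernel[OF K f]])
  also have "\<dots> \<le> L1_norm f"
    unfolding L1_norm_def
    by (intro nn_integral_mono ennreal_leI) (use K in \<open>auto simp: norm_mult mult_left_le unit_kernel_def\<close>)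
  finally show ?thesis .
qed

lemma Linf_norm_kernel_op_le:
  assumes K: "unit_kernel K" and f: "f \<in> L1"
  shows "Linf_norm (kernel_op K f) \<le> L1_norm f"
  unfolding Linf_norm_def
  using measurable_completion[of "kernel_op K f" lborel borel] borel_measurable_kernel_op[OF K f]
    norm_kernel_op_le[OF K f]
  by (intro esssup_I) auto

text \<open>
  Linearity and invariance under changes on null sets hold at every point, because the operator is
  given by an integral for each \<open>y\<close>.
\<close>

lemma linear_kernel_op:
  assumes K: "unit_kernel K"
  shows "linear_L1_Linf (kernel_op K)"
  unfolding linear_L1_Linf_def
proof (intro conjI ballI allI impI AE_I2)
  fix f assume f: "f \<in> L1"
  have "L1_norm f < \<infinity>"
    using f by (simp add: L1_def L1_norm_def integrable_iff_bounded)
  then show "kernel_op K f \<in> Linf"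
    unfolding Linf_def
    using Linf_norm_kernel_op_le[OF K f] borel_measurable_kernel_op[OF K f]
    by (auto intro: measurable_completion)
  fix y
  show "kernel_op K (\<lambda>x. c * f x) y = c * kernel_op K f y" for c
    by (simp add: kernel_op_def mult.assoc)
  fix g assume g: "g \<in> L1"
  show "kernel_op K (\<lambda>x. f x + g x) y = kernel_op K f y + kernel_op K g y"
    unfolding kernel_op_def
    using integrable_times_unit_kernel[OF K f] integrable_times_unit_kernel[OF K g]
    by (simp add: distrib_right)
  show "kernel_op K f y = kernel_op K g y" if "AE x in lebesgue. f x = g x"
    using kernel_op_cong_AE[OF K f g that] by simp
qed

text \<open>
  Both sides are the double integral of \<open>f(x) K(x, y)\<close> times the conjugate of \<open>g(y)\<close>, which
  converges absolutely because \<open>K\<close> is bounded and \<open>f\<close>, \<open>g\<close> are integrable.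
\<close>

lemma is_adjoint_kernel_op:
  assumes K: "unit_kernel K"
  shows "is_adjoint (kernel_op K) (kernel_op (adjoint_kernel K))"
  unfolding is_adjoint_def
proof (intro conjI ballI linear_kernel_op unit_kernel_adjoint K)
  fix f g assume f: "f \<in> L1" and g: "g \<in> L1"
  obtain f' where f': "integrable lborel f'" "AE x in lborel. f x = f' x"
    "kernel_op K f = (\<lambda>y. LINT x|lborel. f' x * K x y)"
    using kernel_op_representative[OF K f] .
  obtain g' where g': "integrable lborel g'" "AE x in lborel. g x = g' x"
    "kernel_op (adjoint_kernel K) g = (\<lambda>x. LINT y|lborel. g' y * adjoint_kernel K y x)"
    using kernel_op_representative[OF unit_kernel_adjoint[OF K] g] .
  have [measurable]: "f' \<in> borel_measurable borel" "g' \<in> borel_measurable borel"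
    "kernel_op K f \<in> borel_measurable borel" "kernel_op (adjoint_kernel K) g \<in> borel_measurable borel"
    using borel_measurable_integrable[OF f'(1)] borel_measurable_integrable[OF g'(1)]
      borel_measurable_kernel_op[OF K f] borel_measurable_kernel_op[OF unit_kernel_adjoint[OF K] g]
    by simp_all
  have [measurable]: "f \<in> borel_measurable lebesgue" "g \<in> borel_measurable lebesgue"
    using f g by (auto simp: L1_def)
  have [measurable]: "f' \<in> borel_measurable lebesgue" "g' \<in> borel_measurable lebesgue"
    "kernel_op K f \<in> borel_measurable lebesgue" "kernel_op (adjoint_kernel K) g \<in> borel_measurable lebesgue"
    by (simp_all add: measurable_completion)
  have "(LINT y|lebesgue. kernel_op K f y * cnj (g y)) = (LINT y|lebesgue. kernel_op K f y * cnj (g' y))"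
    using AE_completion[OF g'(2)] by (intro integral_cong_AE) auto
  also have "\<dots> = (LINT y|lborel. kernel_op K f y * cnj (g' y))"
    by (intro integral_completion) measurable
  also have "\<dots> = (LINT x|lborel. f' x * (LINT y|lborel. K x y * cnj (g' y)))"
    unfolding f'(3) by (rule Fubini_kernel) (use K f' g' in \<open>auto simp: unit_kernel_def\<close>)
  also have "\<dots> = (LINT x|lborel. f' x * cnj (kernel_op (adjoint_kernel K) g x))"
  proof -
    have "(LINT y|lborel. K x y * cnj (g' y)) = cnj (LINT y|lborel. g' y * adjoint_kernel K y x)" for x
    proof -
      have "(LINT y|lborel. K x y * cnj (g' y)) = (LINT y|lborel. cnj (g' y * adjoint_kernel K y x))"
        by (intro Bochner_Integration.integral_cong refl) (simp add: adjoint_kernel_def)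
      also have "\<dots> = cnj (LINT y|lborel. g' y * adjoint_kernel K y x)"
        by (rule Bochner_Integration.integral_cnj)
      finally show ?thesis .
    qed
    then show ?thesis
      by (simp only: g'(3))
  qed
  also have "\<dots> = (LINT x|lebesgue. f' x * cnj (kernel_op (adjoint_kernel K) g x))"
    by (intro integral_completion[symmetric]) measurable
  also have "\<dots> = (LINT x|lebesgue. f x * cnj (kernel_op (adjoint_kernel K) g x))"
    using AE_completion[OF f'(2)] by (intro integral_cong_AE) auto
  finally show "(LINT y|lebesgue. kernel_op K f y * cnj (g y))
     = (LINT x|lebesgue. f x * cnj (kernel_op (adjoint_kernel K) g x))" .
qed

section \<open>The linear canonical transformation\<close>

text \<open>
  The factor \<open>sqrt \<bar>b\<bar>\<close> of the rescaled transformation cancels its normalisation, so that only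
  the phase constant remains and the kernel has modulus one.
\<close>

definition lct_kernel :: "real \<Rightarrow> real \<Rightarrow> real \<Rightarrow> real \<Rightarrow> real \<Rightarrow> complex" where
  "lct_kernel a b d x \<xi> = iexp (- (pi * sgn b / 4)) * iexp (pi * (d * \<xi>\<^sup>2 - 2 * x * \<xi> + a * x\<^sup>2) / b)"

lemma unit_kernel_lct: "unit_kernel (lct_kernel a b d)"
proof -
  have "case_prod (lct_kernel a b d) \<in> borel_measurable (borel \<Otimes>\<^sub>M borel)"
    unfolding lct_kernel_def by measurable
  moreover have "norm (lct_kernel a b d x \<xi>) \<le> 1" for x \<xi>
    unfolding lct_kernel_def norm_mult norm_exp_i_times by simp
  ultimately show ?thesis by (simp add: unit_kernel_def)
qed

lemma iexp_add: "iexp (u + v) = iexp u * iexp v"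
  by (simp add: distrib_left exp_add)

lemma scaled_lct_eq_kernel_op:
  assumes "M$1$2 \<noteq> 0"
  shows "complex_of_real (sqrt \<bar>M$1$2\<bar>) * lct M f \<xi>
       = kernel_op (lct_kernel (M$1$1) (M$1$2) (M$2$2)) f \<xi>"
proof -
  let ?c = "iexp (- (pi * sgn (M$1$2) / 4))"
  have "complex_of_real (sqrt \<bar>M$1$2\<bar>) \<noteq> 0" using assms by simp
  then have "complex_of_real (sqrt \<bar>M$1$2\<bar>) * lct M f \<xi> = ?c *
     (LINT x|lebesgue. f x * iexp (pi * (M$2$2 * \<xi>\<^sup>2 - 2 * x * \<xi> + M$1$1 * x\<^sup>2) / M$1$2))"
    by (simp add: lct_def Let_def del: of_real_mult of_real_divide of_real_eq_0_iff)
  also have "\<dots> = kernel_op (lct_kernel (M$1$1) (M$1$2) (M$2$2)) f \<xi>"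
    unfolding kernel_op_def lct_kernel_def integral_mult_right_zero[symmetric]
    by (simp only: mult.left_commute)
  finally show ?thesis .
qed

lemma cnj_iexp: "cnj (iexp u) = iexp (- u)"
  by (simp add: exp_cnj)

text \<open>
  The mixed term of the quadratic phase is the only one that couples \<open>x\<close> and \<open>\<xi>\<close>; it is a Fourier
  phase of frequency \<open>2 \<pi> \<xi> / b\<close>.
\<close>

lemma lct_kernel_split:
  "lct_kernel a b d x \<xi> = iexp (pi * a * x\<^sup>2 / b) * iexp (- ((2 * pi / b * \<xi>) * x))
     * (iexp (- (pi * sgn b / 4)) * iexp (pi * d * \<xi>\<^sup>2 / b))"
proof -
  have "pi * (d * \<xi>\<^sup>2 - 2 * x * \<xi> + a * x\<^sup>2) / b
      = pi * a * x\<^sup>2 / b + - ((2 * pi / b * \<xi>) * x) + pi * d * \<xi>\<^sup>2 / b"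
    by (simp add: distrib_left right_diff_distrib add_divide_distrib diff_divide_distrib mult_ac)
  then show ?thesis
    unfolding lct_kernel_def by (simp only: iexp_add mult_ac)
qed

text \<open>
  Fourier inversion applies to the chirped function \<open>F\<close>: its transform is integrable because, up to
  a dilation and a unimodular factor, it is \<open>A f\<close>, which is in \<open>L\<^sup>1\<close> by hypothesis.
\<close>

lemma adjoint_lct_kernel_op:
  assumes b: "b \<noteq> 0" and f: "f \<in> L1" and Af: "kernel_op (lct_kernel a b d) f \<in> L1"
  shows "AE x in lborel. norm (kernel_op (adjoint_kernel (lct_kernel a b d)) (kernel_op (lct_kernel a b d) f) x)
     = \<bar>b\<bar> * norm (f x)"
proof -
  let ?K = "lct_kernel a b d"
  obtain f' where f': "integrable lborel f'" "AE x in lborel. f x = f' x"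
    "kernel_op ?K f = (\<lambda>\<xi>. LINT x|lborel. f' x * ?K x \<xi>)"
    using kernel_op_representative[OF unit_kernel_lct f] .
  have [measurable]: "f' \<in> borel_measurable borel" using f'(1) by auto
  define F where "F = (\<lambda>x. f' x * iexp (pi * a * x\<^sup>2 / b))"
  have [measurable]: "F \<in> borel_measurable borel" unfolding F_def by measurable
  have F: "integrable lborel F"
    by (rule Bochner_Integration.integrable_bound[OF f'(1)])
       (auto simp: F_def norm_mult simp del: of_real_mult of_real_divide)
  define Fh where "Fh = (\<lambda>t. LINT y|lborel. F y * iexp (- (t * y)))"
  have [measurable]: "Fh \<in> borel_measurable borel" unfolding Fh_def by measurable
  define c where "c = (\<lambda>\<xi>. iexp (- (pi * sgn b / 4)) * iexp (pi * d * \<xi>\<^sup>2 / b))"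
  have [measurable]: "c \<in> borel_measurable borel" unfolding c_def by measurable
  have c1: "norm (c \<xi>) = 1" for \<xi>
    unfolding c_def by (simp add: norm_mult del: of_real_mult of_real_divide of_real_minus)
  have Afe: "kernel_op ?K f \<xi> = Fh (2 * pi / b * \<xi>) * c \<xi>" for \<xi>
    unfolding f'(3) Fh_def F_def c_def lct_kernel_split
    by (simp only: mult.assoc[symmetric] integral_mult_left_zero)
  have Afi: "integrable lborel (kernel_op ?K f)"
    using Af borel_measurable_kernel_op[OF unit_kernel_lct f] by (simp add: L1_def integrable_completion)
  have "integrable lborel (\<lambda>\<xi>. Fh (0 + 2 * pi / b * \<xi>))"
    by (rule Bochner_Integration.integrable_bound[OF Afi]) (auto simp: Afe norm_mult c1)
  then have Fh: "integrable lborel Fh"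
    using b lborel_integrable_real_affine_iff[of "2 * pi / b" Fh 0] by simp
  \<comment> \<open>The chirp \<open>c\<close> meets its conjugate and drops out; the substitution \<open>t = 2 \<pi> \<xi> / b\<close> contributes
    the factor \<open>\<bar>b\<bar> / (2 \<pi>)\<close>. The summand \<open>0\<close> matches the affine substitution rule.\<close>
  have B: "kernel_op (adjoint_kernel ?K) (kernel_op ?K f) x
     = iexp (- (pi * a * x\<^sup>2 / b)) * (\<bar>b\<bar> / (2 * pi)) * (LINT t|lborel. Fh t * iexp (t * x))" for x
  proof -
    have "kernel_op (adjoint_kernel ?K) (kernel_op ?K f) x
      = (LINT \<xi>|lborel. kernel_op ?K f \<xi> * adjoint_kernel ?K \<xi> x)"
      by (rule kernel_op_borel[OF unit_kernel_adjoint[OF unit_kernel_lct] Afi])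
    also have "\<dots> = (LINT \<xi>|lborel. iexp (- (pi * a * x\<^sup>2 / b)) * (Fh (0 + 2 * pi / b * \<xi>) * iexp ((0 + 2 * pi / b * \<xi>) * x)))"
    proof (intro Bochner_Integration.integral_cong refl)
      fix \<xi>
      have cc: "c \<xi> * cnj (c \<xi>) = 1" using c1[of \<xi>] by (simp add: complex_norm_square[symmetric])
      have "adjoint_kernel ?K \<xi> x = iexp (- (pi * a * x\<^sup>2 / b)) * iexp ((2 * pi / b * \<xi>) * x) * cnj (c \<xi>)"
        unfolding adjoint_kernel_def lct_kernel_split c_def
        by (simp only: complex_cnj_mult cnj_iexp minus_minus)
      then have "kernel_op ?K f \<xi> * adjoint_kernel ?K \<xi> x = (c \<xi> * cnj (c \<xi>)) *
         (iexp (- (pi * a * x\<^sup>2 / b)) * (Fh (2 * pi / b * \<xi>) * iexp ((2 * pi / b * \<xi>) * x)))"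
        unfolding Afe by (simp only: mult_ac)
      then show "kernel_op ?K f \<xi> * adjoint_kernel ?K \<xi> x =
         iexp (- (pi * a * x\<^sup>2 / b)) * (Fh (0 + 2 * pi / b * \<xi>) * iexp ((0 + 2 * pi / b * \<xi>) * x))"
        by (simp only: cc mult_1_left add_0_left)
    qed
    also have "\<dots> = iexp (- (pi * a * x\<^sup>2 / b)) * (LINT \<xi>|lborel. Fh (0 + 2 * pi / b * \<xi>) * iexp ((0 + 2 * pi / b * \<xi>) * x))"
      by (rule integral_mult_right_zero)
    also have "(LINT t|lborel. Fh t * iexp (t * x)) = (2 * pi / \<bar>b\<bar>) *
        (LINT \<xi>|lborel. Fh (0 + 2 * pi / b * \<xi>) * iexp ((0 + 2 * pi / b * \<xi>) * x))"
      using b by (subst lborel_integral_real_affine[where c="2 * pi / b" and t=0])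
         (auto simp: scaleR_conv_of_real abs_mult)
    then have "(LINT \<xi>|lborel. Fh (0 + 2 * pi / b * \<xi>) * iexp ((0 + 2 * pi / b * \<xi>) * x))
        = (\<bar>b\<bar> / (2 * pi)) * (LINT t|lborel. Fh t * iexp (t * x))"
      using b by simp
    finally show ?thesis by (simp only: mult.assoc)
  qed
  have "AE x in lborel. (LINT t|lborel. Fh t * iexp (t * x)) = 2 * pi * F x"
    using fourier_inversion_L1[OF F] Fh unfolding Fh_def by blast
  then show ?thesis
    using f'(2)
  proof eventually_elim
    case (elim x)
    show ?case
      unfolding B elim by (simp add: norm_mult F_def del: of_real_mult of_real_divide of_real_minus)
  qed
qed

lemma Linf_norm_scale_le:
  assumes "0 < k" and f: "f \<in> borel_measurable lebesgue"
    and eq: "AE x in lebesgue. norm (g x) = k * norm (f x)"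
  shows "ennreal k * Linf_norm f \<le> Linf_norm g"
proof -
  have "AE x in lebesgue. ennreal (norm (f x)) \<le> ennreal (1 / k) * Linf_norm g"
    using eq esssup_AE[of "\<lambda>x. ennreal (norm (g x))" lebesgue]
  proof eventually_elim
    case (elim x)
    have "ennreal (norm (f x)) = ennreal (1 / k) * ennreal (norm (g x))"
      using assms(1) elim(1) by (simp add: ennreal_mult[symmetric])
    then show ?case using elim(2) by (simp add: Linf_norm_def mult_left_mono)
  qed
  then have "Linf_norm f \<le> ennreal (1 / k) * Linf_norm g"
    using f unfolding Linf_norm_def[of f] by (intro esssup_I) auto
  then have "ennreal k * Linf_norm f \<le> ennreal k * (ennreal (1 / k) * Linf_norm g)"
    by (intro mult_left_mono) auto
  also have "\<dots> = Linf_norm g"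
    using assms(1) by (simp add: mult.assoc[symmetric] ennreal_mult[symmetric])
  finally show ?thesis .
qed

theorem theorem4p7:
  fixes M :: "real^2^2"
  assumes "det M = 1"
    and "M$1$2 \<noteq> 0"
  shows "hadamard \<bar>M$1$2\<bar> (\<lambda>f \<xi>. complex_of_real (sqrt \<bar>M$1$2\<bar>) * lct M f \<xi>)"
proof -
  let ?K = "lct_kernel (M$1$1) (M$1$2) (M$2$2)"
  have A: "(\<lambda>f \<xi>. complex_of_real (sqrt \<bar>M$1$2\<bar>) * lct M f \<xi>) = kernel_op ?K"
    using scaled_lct_eq_kernel_op[OF assms(2)] by (intro ext)
  have K: "unit_kernel ?K" by (rule unit_kernel_lct)
  have "ennreal \<bar>M$1$2\<bar> * Linf_norm f \<le> Linf_norm (kernel_op (adjoint_kernel ?K) (kernel_op ?K f))"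
    if "f \<in> L1" "kernel_op ?K f \<in> L1" for f
  proof (rule Linf_norm_scale_le)
    show "f \<in> borel_measurable lebesgue"
      using that(1) by (simp add: L1_def)
    show "AE x in lebesgue. norm (kernel_op (adjoint_kernel ?K) (kernel_op ?K f) x) = \<bar>M$1$2\<bar> * norm (f x)"
      by (rule AE_completion[OF adjoint_lct_kernel_op[OF assms(2) that]])
  qed (use assms(2) in simp)
  then show ?thesis
    unfolding A hadamard_def
    using assms(2) linear_kernel_op[OF K] Linf_norm_kernel_op_le[OF K] is_adjoint_kernel_op[OF K] by auto
qed

end
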